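(* For any graph $G$, $\operatorname{lbox}(G)\le \operatorname{pdim}(G)$.
   Context: All graphs are finite, simple and undirected. An interval graph is a graph whose vertices can be mapped to closed intervals of the real line so that two distinct vertices are adjacent if and only if their intervals intersect. For graphs $G, I_1,\dots,I_k$ on the same vertex set, $G=\bigcap_{i=1}^k I_i$ means $E(G)=E(I_1)\cap\cdots\cap E(I_k)$. A vertex is universal in a graph if it is adjacent to all other vertices of that graph, and non-universal otherwise. The local boxicity $\operatorname{lbox}(G)$ is the smallest positive integer $l$ such that, for some $k$, $G=\bigcap_{i=1}^k I_i$ where each $I_i$ is an interval graph on $V(G)$ and each vertex of $G$ is a non-universal vertex in at most $l$ of the graphs $I_1,\dots,I_k$. The product dimension $\operatorname{pdim}(G)$ is the minimum positive integer $k$ for which there exists a function $f:V(G)\to\mathbb{N}^k$ such that $uv\in E(G)$ if and only if $f(u)$ and $f(v)$ differ in exactly $k$ coordinates (i.e. in every coordinate). *)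

theory Defs
  imports Complex_Main "Graph_Theory.Pair_Digraph"
begin

text \<open>
  Finite simple undirected graphs are given by the locale predicate \<^const>\<open>pair_graph\<close>: the vertex
  set is finite, and the edge set is a symmetric irreflexive relation on it.  An undirected
  edge \<open>uv\<close> is thus the pair of arcs \<open>(u, v)\<close> and \<open>(v, u)\<close>, and intersecting edge sets amounts
  to intersecting arc sets.
\<close>

definition interval_graph :: "'a pair_pre_digraph \<Rightarrow> bool" where
  "interval_graph I \<longleftrightarrow> pair_graph I \<and>
     (\<exists>l r :: 'a \<Rightarrow> real.
        (\<forall>v \<in> pverts I. l v \<le> r v) \<and>
        (\<forall>u \<in> pverts I. \<forall>v \<in> pverts I. u \<noteq> v \<longrightarrow>
           ((u, v) \<in> parcs I \<longleftrightarrow> {l u..r u} \<inter> {l v..r v} \<noteq> {})))"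

definition universal_in :: "'a pair_pre_digraph \<Rightarrow> 'a \<Rightarrow> bool" where
  "universal_in G v \<longleftrightarrow> (\<forall>u \<in> pverts G. u \<noteq> v \<longrightarrow> (v, u) \<in> parcs G)"

text \<open>The family \<open>I\<^sub>1, \<dots>, I\<^sub>k\<close> is indexed by \<open>0, \<dots>, k - 1\<close>.\<close>

definition is_interval_rep :: "'a pair_pre_digraph \<Rightarrow> nat \<Rightarrow> (nat \<Rightarrow> 'a pair_pre_digraph) \<Rightarrow> bool" where
  "is_interval_rep G k I \<longleftrightarrow> k \<ge> 1 \<and>
     (\<forall>i<k. interval_graph (I i) \<and> pverts (I i) = pverts G) \<and>
     parcs G = (\<Inter>i<k. parcs (I i))"

definition is_local_box_rep ::
    "'a pair_pre_digraph \<Rightarrow> nat \<Rightarrow> nat \<Rightarrow> (nat \<Rightarrow> 'a pair_pre_digraph) \<Rightarrow> bool" where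
  "is_local_box_rep G l k I \<longleftrightarrow> is_interval_rep G k I \<and>
     (\<forall>v \<in> pverts G. card {i. i < k \<and> \<not> universal_in (I i) v} \<le> l)"

definition lbox :: "'a pair_pre_digraph \<Rightarrow> nat" where
  "lbox G = (LEAST l. l \<ge> 1 \<and> (\<exists>k I. is_local_box_rep G l k I))"

text \<open>
  A map into \<open>\<nat>\<^sup>k\<close> is a function \<open>'a \<Rightarrow> nat \<Rightarrow> nat\<close> of which only the coordinates below \<open>k\<close>
  matter.
\<close>

definition is_product_rep :: "'a pair_pre_digraph \<Rightarrow> nat \<Rightarrow> ('a \<Rightarrow> nat \<Rightarrow> nat) \<Rightarrow> bool" where
  "is_product_rep G k f \<longleftrightarrow>
     (\<forall>u \<in> pverts G. \<forall>v \<in> pverts G. (u, v) \<in> parcs G \<longleftrightarrow> (\<forall>i<k. f u i \<noteq> f v i))"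

definition pdim :: "'a pair_pre_digraph \<Rightarrow> nat" where
  "pdim G = (LEAST k. k \<ge> 1 \<and> (\<exists>f. is_product_rep G k f))"

text \<open>Both minima are attained for every finite simple graph.\<close>

lemma pair_graph_sym: "pair_graph G \<Longrightarrow> (u, v) \<in> parcs G \<Longrightarrow> (v, u) \<in> parcs G"
  by (metis pair_graph.axioms(2) pair_pseudo_graph.axioms(2) pair_sym_digraph.pair_sym_arcs
      symmetric_def symD with_proj_simps(3))

lemma pair_graph_neq: "pair_graph G \<Longrightarrow> (u, v) \<in> parcs G \<Longrightarrow> u \<noteq> v"
  using pair_graph.axioms(1) pair_digraph.axioms(2) pair_loopfree_digraph.pair_no_loops by fastforce

lemma pair_graph_verts:
  "pair_graph G \<Longrightarrow> parcs G \<subseteq> pverts G \<times> pverts G"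
  "pair_graph G \<Longrightarrow> finite (pverts G)"
proof -
  assume "pair_graph G"
  then interpret pair_graph G .
  show "parcs G \<subseteq> pverts G \<times> pverts G" using arc_fst_in_verts arc_snd_in_verts by fastforce
  show "finite (pverts G)" by (rule pair_finite_verts)
qed

lemma ex_product_rep:
  assumes G: "pair_graph G"
  shows "\<exists>k\<ge>1. \<exists>f. is_product_rep G k f"
proof -
  define N where "N = pverts G \<times> pverts G - parcs G"
  have "finite N" using pair_graph_verts(2)[OF G] by (simp add: N_def)
  then obtain h where h: "bij_betw h {0..<card N} N"
    using ex_bij_betw_nat_finite by blast
  obtain g :: "_ \<Rightarrow> nat" where g: "inj_on g (pverts G)"
    using finite_imp_inj_to_nat_seg[OF pair_graph_verts(2)[OF G]] by metis
  define f where "f w i = (if i < card N \<and> (w = fst (h i) \<or> w = snd (h i)) then 0 else Suc (g w))"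
    for w i
  have "(u, v) \<in> parcs G \<longleftrightarrow> (\<forall>i<Suc (card N). f u i \<noteq> f v i)"
    if uv: "u \<in> pverts G" "v \<in> pverts G" for u v
  proof
    assume e: "(u, v) \<in> parcs G"
    have "u \<noteq> v" "(v, u) \<in> parcs G" using pair_graph_neq[OF G e] pair_graph_sym[OF G e] by auto
    show "\<forall>i<Suc (card N). f u i \<noteq> f v i"
    proof (intro allI impI notI)
      fix i assume i: "i < Suc (card N)" and eq: "f u i = f v i"
      have "g u \<noteq> g v" using g uv \<open>u \<noteq> v\<close> by (auto dest: inj_onD)
      with eq have *: "i < card N" "u = fst (h i) \<or> u = snd (h i)" "v = fst (h i) \<or> v = snd (h i)"
        by (auto simp: f_def split: if_splits)
      have "h i \<in> N" using h *(1) by (auto simp: bij_betw_def)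
      moreover have "h i = (u, v) \<or> h i = (v, u)" using * \<open>u \<noteq> v\<close> by (metis prod.collapse)
      ultimately show False using e \<open>(v, u) \<in> parcs G\<close> by (auto simp: N_def)
    qed
  next
    assume a: "\<forall>i<Suc (card N). f u i \<noteq> f v i"
    show "(u, v) \<in> parcs G"
    proof (rule ccontr)
      assume "(u, v) \<notin> parcs G"
      then have "(u, v) \<in> N" using uv by (simp add: N_def)
      then obtain i where i: "i < card N" "h i = (u, v)"
        using h by (force simp: bij_betw_def image_iff)
      then have "f u i = f v i" by (simp add: f_def)
      then show False using a i by auto
    qed
  qed
  then have "is_product_rep G (Suc (card N)) f" by (simp add: is_product_rep_def)
  then show ?thesis by (metis le_add1 plus_1_eq_Suc)
qed

lemma ex_local_box_rep:
  assumes G: "pair_graph G"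
  shows "\<exists>l\<ge>1. \<exists>k I. is_local_box_rep G l k I"
proof -
  define N where "N = {(u, v) \<in> pverts G \<times> pverts G. u \<noteq> v} - parcs G"
  have fin: "finite (pverts G)" by (rule pair_graph_verts(2)[OF G])
  have "N \<subseteq> pverts G \<times> pverts G" by (auto simp: N_def)
  then have "finite N" using fin by (meson finite_SigmaI finite_subset)
  then obtain h where h: "bij_betw h {0..<card N} N"
    using ex_bij_betw_nat_finite by blast
  define I where "I i = \<lparr>pverts = pverts G, parcs = {(u, v). u \<in> pverts G \<and> v \<in> pverts G \<and>
      u \<noteq> v \<and> (i < card N \<longrightarrow> (u, v) \<noteq> h i \<and> (v, u) \<noteq> h i)}\<rparr>" for i
  have pg: "pair_graph (I i)" for i
    using fin
    by unfold_locales
      (auto simp: I_def symmetric_def sym_def intro: finite_subset[of _ "pverts G \<times> pverts G"])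
  have ig: "interval_graph (I i)" for i
  proof (cases "i < card N")
    case True
    then have "h i \<in> N" using h by (auto simp: bij_betw_def)
    then obtain a b where ab: "h i = (a, b)" "a \<noteq> b" by (auto simp: N_def)
    show ?thesis unfolding interval_graph_def
      by (rule conjI[OF pg], rule exI[of _ "\<lambda>v. if v = b then 2 else 0"],
          rule exI[of _ "\<lambda>v. if v = a then 0 else 2"]) (use True ab in \<open>auto simp: I_def\<close>)
  next
    case False
    show ?thesis unfolding interval_graph_def
      by (rule conjI[OF pg], rule exI[of _ "\<lambda>_. 0"], rule exI[of _ "\<lambda>_. 1"])
        (use False in \<open>auto simp: I_def\<close>)
  qed
  have "parcs G = (\<Inter>i<Suc (card N). parcs (I i))"
  proof (intro equalityI subsetI)
    fix e assume e: "e \<in> parcs G"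
    obtain u v where uv: "e = (u, v)" by force
    have "(u, v) \<in> parcs (I i)" for i
    proof -
      have "(u, v) \<notin> N" "(v, u) \<notin> N" using e uv pair_graph_sym[OF G] by (auto simp: N_def)
      moreover have "i < card N \<Longrightarrow> h i \<in> N" using h by (auto simp: bij_betw_def)
      ultimately show ?thesis
        using e uv pair_graph_verts(1)[OF G] pair_graph_neq[OF G] by (auto simp: I_def)
    qed
    then show "e \<in> (\<Inter>i<Suc (card N). parcs (I i))" using uv by auto
  next
    fix e assume e: "e \<in> (\<Inter>i<Suc (card N). parcs (I i))"
    then have "e \<in> parcs (I (card N))" by auto
    then obtain u v where uv: "e = (u, v)" "u \<in> pverts G" "v \<in> pverts G" "u \<noteq> v"
      by (auto simp: I_def)
    show "e \<in> parcs G"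
    proof (rule ccontr)
      assume "e \<notin> parcs G"
      then have "(u, v) \<in> N" using uv by (simp add: N_def)
      then obtain i where i: "i < card N" "h i = (u, v)"
        using h by (force simp: bij_betw_def image_iff)
      then have "e \<notin> parcs (I i)" using uv by (auto simp: I_def)
      then show False using e i by auto
    qed
  qed
  then have "is_interval_rep G (Suc (card N)) I"
    using ig by (auto simp: is_interval_rep_def I_def)
  moreover have "card {i. i < Suc (card N) \<and> P i} \<le> Suc (card N)" for P
    using card_mono[of "{..<Suc (card N)}" "{i. i < Suc (card N) \<and> P i}"] by auto
  ultimately have "is_local_box_rep G (Suc (card N)) (Suc (card N)) I"
    by (simp add: is_local_box_rep_def)
  then show ?thesis by (metis le_add1 plus_1_eq_Suc)
qed

end

theory Submission
  imports Defs
begin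

text \<open>
  Let \<open>f\<close> embed \<open>G\<close> into \<open>\<nat>\<^sup>k\<close>.  For each coordinate \<open>j < k\<close> and value \<open>c\<close>, take the complete graph
  with the edges inside the class \<open>{v. f v j = c}\<close> removed: an interval graph (distinct points for
  the class, one long interval for every other vertex) whose non-universal vertices lie in the
  class.  These graphs intersect in \<open>G\<close>, and each vertex lies in exactly one class per coordinate.
\<close>

definition complete_minus_clique :: "'a set \<Rightarrow> 'a set \<Rightarrow> 'a pair_pre_digraph" where
  "complete_minus_clique V C =
     \<lparr>pverts = V, parcs = {(u, v). u \<in> V \<and> v \<in> V \<and> u \<noteq> v \<and> \<not> (u \<in> C \<and> v \<in> C)}\<rparr>"

lemma interval_graph_complete_minus_clique:
  assumes "finite V"
  shows "interval_graph (complete_minus_clique V C)"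
proof -
  have "pair_graph (complete_minus_clique V C)"
    using assms
    by unfold_locales
      (auto simp: complete_minus_clique_def symmetric_def sym_def
        intro: finite_subset[of _ "V \<times> V"])
  moreover obtain g :: "'a \<Rightarrow> nat" and n where g: "g ` V = {i. i < n}" "inj_on g V"
    using finite_imp_inj_to_nat_seg[OF assms] by metis
  have "g v < n" if "v \<in> V" for v using g(1) that by blast
  then have "\<exists>l r :: 'a \<Rightarrow> real. (\<forall>v \<in> V. l v \<le> r v) \<and>
      (\<forall>u \<in> V. \<forall>v \<in> V. u \<noteq> v \<longrightarrow>
         (\<not> (u \<in> C \<and> v \<in> C) \<longleftrightarrow> {l u..r u} \<inter> {l v..r v} \<noteq> {}))"
    using inj_onD[OF g(2)]
    \<comment> \<open>The injective numbering \<open>g\<close> keeps the points distinct; its values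
      are below \<open>n\<close>, so each point meets the long interval from 0 to
      \<open>n\<close>.\<close>
    by (intro exI[of _ "\<lambda>v. if v \<in> C then real (g v) else 0"]
        exI[of _ "\<lambda>v. if v \<in> C then real (g v) else real n"]) (auto simp: less_imp_le)
  ultimately show ?thesis
    by (simp add: interval_graph_def complete_minus_clique_def)
qed

lemma universal_in_complete_minus_clique:
  "v \<in> V \<Longrightarrow> v \<notin> C \<Longrightarrow> universal_in (complete_minus_clique V C) v"
  by (simp add: universal_in_def complete_minus_clique_def)

lemma local_box_rep_of_product_rep:
  assumes G: "pair_graph G" and k: "k \<ge> 1" and f: "is_product_rep G k f"
  shows "\<exists>n I. is_local_box_rep G k n I"
proof -
  let ?V = "pverts G"
  have fin: "finite ?V" by (rule pair_graph_verts(2)[OF G])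
  then have "finite ((\<lambda>(v, j). f v j) ` (?V \<times> {..<k}))" by simp
  \<comment> \<open>A common bound on all coordinates of the vertices leaves finitely many pairs of
    coordinate and value.\<close>
  then obtain m where m: "\<forall>c \<in> (\<lambda>(v, j). f v j) ` (?V \<times> {..<k}). c < m"
    using finite_nat_set_iff_bounded by blast
  then have less: "f v j < Suc m" if "v \<in> ?V" "j < k" for v j
    using m that by (simp add: less_SucI)
  \<comment> \<open>The index \<open>i\<close> encodes the pair of coordinate
    \<open>i div Suc m\<close> and value \<open>i mod Suc m\<close>. Using \<open>Suc m\<close>
    keeps the modulus positive, and hence the family nonempty, even when \<open>m\<close> is
    0.\<close>
  define C where "C i = {v. f v (i div Suc m) = i mod Suc m}" for i
  define I where "I i = complete_minus_clique ?V (C i)" for i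
  have code: "j * Suc m + c < k * Suc m" "(j * Suc m + c) div Suc m = j"
      "(j * Suc m + c) mod Suc m = c" if "j < k" "c < Suc m" for j c
  proof -
    have "j * Suc m + c < Suc j * Suc m" using that by simp
    also have "\<dots> \<le> k * Suc m" using that by (intro mult_le_mono1) simp
    finally show "j * Suc m + c < k * Suc m" .
    show "(j * Suc m + c) div Suc m = j" "(j * Suc m + c) mod Suc m = c"
      using that by (simp_all del: mult_Suc_right)
  qed
  have "(u, v) \<in> parcs G \<longleftrightarrow> (\<forall>i<k * Suc m. (u, v) \<in> parcs (I i))" for u v
  proof
    assume e: "(u, v) \<in> parcs G"
    then have uv: "u \<in> ?V" "v \<in> ?V" "u \<noteq> v"
      using pair_graph_verts(1)[OF G] pair_graph_neq[OF G] by auto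
    with e f have ne: "\<forall>j<k. f u j \<noteq> f v j" by (simp add: is_product_rep_def)
    \<comment> \<open>Two members of \<open>C i\<close> agree in coordinate
      \<open>i div Suc m\<close>, which is below \<open>k\<close>.\<close>
    have "\<not> (u \<in> C i \<and> v \<in> C i)" if "i < k * Suc m" for i
      using ne less_mult_imp_div_less[OF that] by (auto simp: C_def)
    then show "\<forall>i<k * Suc m. (u, v) \<in> parcs (I i)"
      using uv by (simp add: I_def complete_minus_clique_def)
  next
    assume a: "\<forall>i<k * Suc m. (u, v) \<in> parcs (I i)"
    \<comment> \<open>Some graph is in the family, and its arcs force \<open>u\<close> and
      \<open>v\<close> into the vertex set, where \<open>f\<close> decides adjacency.\<close>
    moreover have "0 < k * Suc m" using k by simp
    ultimately have "(u, v) \<in> parcs (I 0)" by blast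
    then have uv: "u \<in> ?V" "v \<in> ?V" by (auto simp: I_def complete_minus_clique_def)
    have "f u j \<noteq> f v j" if j: "j < k" for j
    proof
      assume eq: "f u j = f v j"
      \<comment> \<open>This index encodes coordinate \<open>j\<close> with the common value, so one
        class would contain both vertices.\<close>
      let ?i = "j * Suc m + f u j"
      note i = code[OF j less[OF uv(1) j]]
      have "u \<in> C ?i" "v \<in> C ?i" unfolding C_def mem_Collect_eq i(2,3) using eq by simp_all
      then show False using a i(1) by (auto simp: I_def complete_minus_clique_def)
    qed
    then show "(u, v) \<in> parcs G" using f uv by (simp add: is_product_rep_def)
  qed
  then have "parcs G = (\<Inter>i<k * Suc m. parcs (I i))" by auto
  moreover have "interval_graph (I i) \<and> pverts (I i) = ?V" for i
    using interval_graph_complete_minus_clique[OF fin]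
    by (simp add: I_def complete_minus_clique_def)
  ultimately have "is_interval_rep G (k * Suc m) I"
    using k by (simp add: is_interval_rep_def)
  moreover have "card {i. i < k * Suc m \<and> \<not> universal_in (I i) v} \<le> k" if v: "v \<in> ?V" for v
  proof -
    \<comment> \<open>Only classes containing \<open>v\<close> count; in coordinate \<open>j\<close>
      that is the class of value \<open>f v j\<close>, so there are at most
      \<open>k\<close>.\<close>
    have "{i. i < k * Suc m \<and> \<not> universal_in (I i) v} \<subseteq> (\<lambda>j. j * Suc m + f v j) ` {..<k}"
    proof clarify
      fix i assume i: "i < k * Suc m" and "\<not> universal_in (I i) v"
      then have "v \<in> C i" using universal_in_complete_minus_clique[OF v] by (auto simp: I_def)
      then have "i = i div Suc m * Suc m + f v (i div Suc m)"
        unfolding C_def mem_Collect_eq by (simp only: div_mult_mod_eq)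
      then show "i \<in> (\<lambda>j. j * Suc m + f v j) ` {..<k}"
        using less_mult_imp_div_less[OF i] by blast
    qed
    then show ?thesis using surj_card_le[of "{..<k}"] by simp
  qed
  ultimately show ?thesis unfolding is_local_box_rep_def by blast
qed

theorem theorem18:
  fixes G :: "'a pair_pre_digraph"
  assumes "pair_graph G"
  shows "lbox G \<le> pdim G"
proof -
  have "pdim G \<ge> 1 \<and> (\<exists>f. is_product_rep G (pdim G) f)"
    unfolding pdim_def using ex_product_rep[OF assms] by (rule LeastI_ex)
  \<comment> \<open>As the minimum \<open>pdim G\<close> is attained, it is itself a candidate in
    the minimum defining \<open>lbox G\<close>.\<close>
  then have "pdim G \<ge> 1 \<and> (\<exists>k I. is_local_box_rep G (pdim G) k I)"
    using local_box_rep_of_product_rep[OF assms] by blast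
  then show ?thesis unfolding lbox_def by (rule Least_le)
qed

end
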